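(* Every bipartite outerplanar graph $G$ is leveled planar. Moreover, every breadth first layering of such a graph $G$ gives a leveled planar drawing; that is, there is a leveled planar drawing of $G$ whose levels are the same as the layers of the breadth first layering.
   Context: Graphs are finite, simple and undirected. A leveled planar drawing of a graph is a straight-line crossing-free drawing in the plane such that the vertices are placed on a sequence of parallel lines (levels, numbered consecutively), where each edge joins vertices in two consecutive levels. A graph is leveled planar if it has a leveled planar drawing. A layering of a graph is a partition of its vertices into a sequence of disjoint subsets (layers) such that each edge joins vertices in the same layer or in consecutive layers. A breadth first layering of a (connected) graph is the layering that partitions the vertices by their distances from a fixed starting vertex. *)

theory Defs
  imports "HOL-Analysis.Analysis"
begin

definition simple_graph :: "'a set \<Rightarrow> 'a set set \<Rightarrow> bool" where
  "simple_graph V E \<longleftrightarrow> finite V \<and> (\<forall>e\<in>E. e \<subseteq> V \<and> card e = 2)"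

definition bipartite :: "'a set \<Rightarrow> 'a set set \<Rightarrow> bool" where
  "bipartite V E \<longleftrightarrow>
     (\<exists>A B. A \<inter> B = {} \<and> A \<union> B = V \<and> (\<forall>e\<in>E. \<exists>a\<in>A. \<exists>b\<in>B. e = {a, b}))"

definition adj :: "'a set set \<Rightarrow> ('a \<times> 'a) set" where
  "adj E = {(u, v). {u, v} \<in> E}"

definition connected_graph :: "'a set \<Rightarrow> 'a set set \<Rightarrow> bool" where
  "connected_graph V E \<longleftrightarrow> (\<forall>u\<in>V. \<forall>v\<in>V. (u, v) \<in> (adj E)\<^sup>*)"

text \<open>The pairs in the \<open>n\<close>-th relational power of the adjacency relation are those joined by a
  walk with \<open>n\<close> edges.  The value is meaningful only if \<open>v\<close> is reachable from \<open>u\<close>.\<close>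

definition graph_dist :: "'a set set \<Rightarrow> 'a \<Rightarrow> 'a \<Rightarrow> nat" where
  "graph_dist E u v = (LEAST n. (u, v) \<in> adj E ^^ n)"

text \<open>Partitions into a sequence of subsets are indexed by all natural numbers; since \<open>V\<close> is
  finite, all but finitely many of the sets are empty.\<close>

definition sequence_partition :: "'a set \<Rightarrow> (nat \<Rightarrow> 'a set) \<Rightarrow> bool" where
  "sequence_partition V L \<longleftrightarrow> disjoint_family L \<and> (\<Union>i. L i) = V"

definition layering :: "'a set \<Rightarrow> 'a set set \<Rightarrow> (nat \<Rightarrow> 'a set) \<Rightarrow> bool" where
  "layering V E L \<longleftrightarrow> sequence_partition V L \<and>
     (\<forall>e\<in>E. \<exists>u v i. e = {u, v} \<and> u \<in> L i \<and> (v \<in> L i \<or> v \<in> L (Suc i)))"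

definition breadth_first_layering :: "'a set \<Rightarrow> 'a set set \<Rightarrow> (nat \<Rightarrow> 'a set) \<Rightarrow> bool" where
  "breadth_first_layering V E L \<longleftrightarrow> connected_graph V E \<and>
     (\<exists>r\<in>V. \<forall>i. L i = {v \<in> V. graph_dist E r v = i})"

text \<open>A crossing-free drawing places each vertex \<open>v\<close> at the point \<open>p v\<close> and draws each edge \<open>e\<close>
  as the point set \<open>D e\<close>, a simple arc joining the images of the ends of \<open>e\<close>.\<close>

definition plane_drawing ::
    "'a set \<Rightarrow> 'a set set \<Rightarrow> ('a \<Rightarrow> complex) \<Rightarrow> ('a set \<Rightarrow> complex set) \<Rightarrow> bool" where
  "plane_drawing V E p D \<longleftrightarrow>
     inj_on p V \<and>
     (\<forall>e\<in>E. \<exists>g. arc g \<and> path_image g = D e \<and> {pathstart g, pathfinish g} = p ` e) \<and>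
     (\<forall>e\<in>E. \<forall>v\<in>V. p v \<in> D e \<longrightarrow> v \<in> e) \<and>
     (\<forall>e\<in>E. \<forall>e'\<in>E. e \<noteq> e' \<longrightarrow> D e \<inter> D e' \<subseteq> p ` (e \<inter> e'))"

text \<open>The outer face is the unbounded component of the complement of the drawing, which is what
  \<^const>\<open>outside\<close> denotes for compact sets in the plane.\<close>

definition outerplanar :: "'a set \<Rightarrow> 'a set set \<Rightarrow> bool" where
  "outerplanar V E \<longleftrightarrow>
     (\<exists>p D. plane_drawing V E p D \<and>
            (\<forall>v\<in>V. p v \<in> frontier (outside (p ` V \<union> (\<Union>e\<in>E. D e)))))"

text \<open>The segment between the images of the ends of \<open>e\<close> is the convex hull of \<open>p ` e\<close>.
  Level \<open>i\<close> is the line \<open>{z. z \<bullet> n = c i}\<close>: the lines share the normal vector \<open>n\<close>, and strict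
  monotonicity of \<open>c\<close> says that they are distinct and numbered in their order in the plane.\<close>

definition leveled_planar_drawing ::
    "'a set \<Rightarrow> 'a set set \<Rightarrow> (nat \<Rightarrow> 'a set) \<Rightarrow> ('a \<Rightarrow> complex) \<Rightarrow> bool" where
  "leveled_planar_drawing V E L p \<longleftrightarrow>
     sequence_partition V L \<and>
     (\<forall>e\<in>E. \<exists>u v i. e = {u, v} \<and> u \<in> L i \<and> v \<in> L (Suc i)) \<and>
     (\<exists>n (c :: nat \<Rightarrow> real). n \<noteq> 0 \<and> strict_mono c \<and> (\<forall>i. \<forall>v\<in>L i. p v \<bullet> n = c i)) \<and>
     plane_drawing V E p (\<lambda>e. convex hull (p ` e))"

definition leveled_planar :: "'a set \<Rightarrow> 'a set set \<Rightarrow> bool" where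
  "leveled_planar V E \<longleftrightarrow> (\<exists>L p. leveled_planar_drawing V E L p)"

lemma graph_dist_step:
  assumes "(r, u) \<in> (adj E)\<^sup>*" and "(u, v) \<in> adj E"
  shows "graph_dist E r v \<le> Suc (graph_dist E r u)"
proof -
  from assms(1) obtain n where "(r, u) \<in> adj E ^^ n"
    using rtrancl_imp_relpow by blast
  then have "(r, u) \<in> adj E ^^ graph_dist E r u"
    unfolding graph_dist_def by (rule LeastI)
  with assms(2) have "(r, v) \<in> adj E ^^ Suc (graph_dist E r u)"
    by auto
  then show ?thesis
    unfolding graph_dist_def by (rule Least_le)
qed

lemma breadth_first_layering_imp_layering:
  assumes G: "simple_graph V E" and L: "breadth_first_layering V E L"
  shows "layering V E L"
proof -
  obtain r where r: "r \<in> V" and Li: "\<And>i. L i = {v \<in> V. graph_dist E r v = i}"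
    and conn: "connected_graph V E"
    using L unfolding breadth_first_layering_def by blast
  have "\<exists>u v i. e = {u, v} \<and> u \<in> L i \<and> (v \<in> L i \<or> v \<in> L (Suc i))" if e: "e \<in> E" for e
  proof -
    obtain x y where xy: "e = {x, y}" "x \<in> V" "y \<in> V"
      using G e unfolding simple_graph_def by (metis card_2_iff insert_subset)
    have "(x, y) \<in> adj E" "(y, x) \<in> adj E"
      using e xy by (auto simp: adj_def insert_commute)
    moreover have "(r, x) \<in> (adj E)\<^sup>*" "(r, y) \<in> (adj E)\<^sup>*"
      using conn r xy by (auto simp: connected_graph_def)
    ultimately have "graph_dist E r y \<le> Suc (graph_dist E r x)"
      "graph_dist E r x \<le> Suc (graph_dist E r y)"
      by (auto intro: graph_dist_step)
    then consider "graph_dist E r y = graph_dist E r x"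
      | "graph_dist E r y = Suc (graph_dist E r x)"
      | "graph_dist E r x = Suc (graph_dist E r y)"
      by linarith
    then show ?thesis
    proof cases
      case 1
      then have "e = {x, y} \<and> x \<in> L (graph_dist E r x) \<and> y \<in> L (graph_dist E r x)"
        using xy by (auto simp: Li)
      then show ?thesis by blast
    next
      case 2
      then have "e = {x, y} \<and> x \<in> L (graph_dist E r x) \<and> y \<in> L (Suc (graph_dist E r x))"
        using xy by (auto simp: Li)
      then show ?thesis by blast
    next
      case 3
      then have "e = {y, x} \<and> y \<in> L (graph_dist E r y) \<and> x \<in> L (Suc (graph_dist E r y))"
        using xy by (auto simp: Li)
      then show ?thesis by blast
    qed
  qed
  moreover have "sequence_partition V L"
    by (auto simp: sequence_partition_def disjoint_family_on_def Li)
  ultimately show ?thesis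
    by (simp add: layering_def)
qed

end

theory Submission
  imports Defs
begin

text \<open>
  The key is a vertex order along a line in which no two edges cross when they are drawn as arcs
  above the line.  Every outerplanar graph has such an order, and its cyclic rotations are again
  such orders, so any given vertex can be made the first one.

  Such an order solves the problem.  Let \<open>r\<close> be first, and sort every breadth first layer of \<open>r\<close> by
  this order.  Bipartiteness makes all edges join consecutive layers.  Let \<open>uv\<close> and \<open>u'v'\<close> be
  edges between layers \<open>i\<close> and \<open>i + 1\<close>, with \<open>u\<close> before \<open>u'\<close> and \<open>v'\<close> before \<open>v\<close>.  Since the edges do not
  cross above the line, one of them is nested in the other in such a way that the vertex
  of layer \<open>i\<close> of one edge lies strictly between the ends of the other edge.  But a walk from \<open>r\<close>
  to a vertex between the ends of an edge passes through one of these ends, which are at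
  distance at least \<open>i\<close>, so the vertex has distance greater than \<open>i\<close>.  Hence the layers, drawn on
  parallel lines in this order, give a straight-line drawing without crossings
  (\<open>leveled_planar_drawing_from_roots\<close>).  Disconnected graphs are layered from a root in each
  component, and the components are placed next to each other.

  The vertex order exists by induction (\<open>outerplanar_imp_noncrossing\<close>).  A graph that splits into
  two parts sharing at most one vertex gets its order by concatenating orders of the parts
  that start with the shared vertex.  Otherwise the graph has a Hamiltonian cycle whose chords
  do not cross, and the order along the cycle is as required.

  Topology enters through two exclusions only.  No outerplanar graph contains three
  internally disjoint paths with common ends and interior vertices on each of them
  (\<open>outerplanar_no_theta\<close>), since one of the three arcs of a theta curve runs inside the closed
  curve formed by the other two (\<open>arc_meets_inside_of_theta\<close>), away from the outer face.  And no
  cycle has two crossing chords (\<open>outerplanar_no_crossing_chords\<close>), since both chords would have to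
  be drawn inside the cycle, where the first one separates the ends of the second.
\<close>

section \<open>Theta curves in the plane\<close>

text \<open>The three arcs of a theta curve are not interchangeable: one of them runs inside the closed
  curve formed by the other two.  If \<open>c3\<close> avoided the inside \<open>I\<close> of \<open>c1 \<union> c2\<close>, then neither
  \<open>c1 \<union> c3\<close> nor \<open>c2 \<union> c3\<close> would separate \<open>I\<close> from infinity, because \<open>I\<close> can be left through
  \<open>x2\<close> and through \<open>x1\<close>.  These two closed curves meet in the connected set \<open>c3\<close>, so by
  Janiszewski's theorem their union would not separate \<open>I\<close> from infinity either, although it
  contains \<open>c1 \<union> c2\<close>.\<close>

lemma arc_meets_inside_of_theta:
  fixes c1 c2 c3 :: "real \<Rightarrow> complex"
  assumes c1: "arc c1" "pathstart c1 = a" "pathfinish c1 = b"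
    and c2: "arc c2" "pathstart c2 = a" "pathfinish c2 = b"
    and c3: "arc c3" "pathstart c3 = a" "pathfinish c3 = b"
    and c12: "path_image c1 \<inter> path_image c2 = {a, b}"
    and c13: "path_image c1 \<inter> path_image c3 = {a, b}"
    and c23: "path_image c2 \<inter> path_image c3 = {a, b}"
    and x1: "x1 \<in> path_image c1" "x1 \<notin> {a, b}" "x1 \<notin> inside (path_image c2 \<union> path_image c3)"
    and x2: "x2 \<in> path_image c2" "x2 \<notin> {a, b}" "x2 \<notin> inside (path_image c1 \<union> path_image c3)"
  shows "path_image c3 \<inter> inside (path_image c1 \<union> path_image c2) \<noteq> {}"
proof
  let ?C1 = "path_image c1" and ?C2 = "path_image c2" and ?C3 = "path_image c3"
  let ?I = "inside (?C1 \<union> ?C2)"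
  assume disj: "?C3 \<inter> ?I = {}"
  have J: "simple_path (c1 +++ reversepath c2)"
    using c1 c2 c12 by (simp add: simple_path_join_loop_eq arc_reversepath)
  have Jimg: "path_image (c1 +++ reversepath c2) = ?C1 \<union> ?C2"
    using c1 c2 by (simp add: path_image_join)
  have I: "?I \<noteq> {}" "connected ?I" "frontier ?I = ?C1 \<union> ?C2"
    using Jordan_inside_outside[OF J] c1 c2 Jimg by auto
  have cpt: "compact ?C1" "compact ?C2" "compact ?C3"
    using c1 c2 c3 by (auto intro: compact_arc_image)
  have bdd: "bounded (?C1 \<union> ?C2 \<union> ?C3)"
    using cpt by (auto intro: compact_imp_bounded)
  obtain y where y: "y \<in> ?I" using I by blast
  obtain z where z: "z \<in> outside (?C1 \<union> ?C2 \<union> ?C3)"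
    using outside_bounded_nonempty[OF bdd] by blast
  \<comment> \<open>The face inside \<open>c1 \<union> c2\<close> reaches \<open>x\<close> across its frontier without meeting the closed curve
    formed by the other two arcs, so it lies outside that curve.\<close>
  have connect: "connected_component (- S) y z"
    if S: "S \<subseteq> ?C1 \<union> ?C2 \<union> ?C3" "S \<inter> ?I = {}" "x \<in> ?C1 \<union> ?C2" "x \<notin> S" "x \<notin> inside S" for S x
  proof -
    have xout: "x \<in> outside S" using that by (simp add: outside_inside)
    have zout: "z \<in> outside S" using z outside_mono[OF S(1)] by blast
    have "connected (insert x ?I)"
      using I(2)
    proof (rule connected_intermediate_closure)
      show "insert x ?I \<subseteq> closure ?I"
        using that(3) I(3) closure_Un_frontier[of ?I] by auto
    qed auto
    moreover have "insert x ?I \<subseteq> - S" using that by auto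
    ultimately have xy: "connected_component (- S) y x"
      using y unfolding connected_component_def by blast
    have "connected (outside S)"
      using bounded_subset[OF bdd S(1)] by (auto intro: connected_outside)
    then have "connected_component (- S) x z"
      using xout zout unfolding connected_component_def
      by (metis Int_commute disjoint_eq_subset_Compl outside_no_overlap)
    with xy show ?thesis by (rule connected_component_trans)
  qed
  have y1: "connected_component (- (?C1 \<union> ?C3)) y z"
    using disj x2 c12 c23 by (intro connect[of _ x2]) (auto dest: inside_no_overlap[THEN equalityD1, THEN subsetD, OF IntI])
  have y2: "connected_component (- (?C2 \<union> ?C3)) y z"
    using disj x1 c12 c13 by (intro connect[of _ x1]) (auto dest: inside_no_overlap[THEN equalityD1, THEN subsetD, OF IntI])
  have "(?C1 \<union> ?C3) \<inter> (?C2 \<union> ?C3) = ?C3"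
    using c12 c13 by auto
  then have "connected_component (- ((?C1 \<union> ?C3) \<union> (?C2 \<union> ?C3))) y z"
    using cpt connected_arc_image[OF c3(1)]
    by (intro Janiszewski[OF _ _ _ y1 y2]) (simp_all add: compact_Un compact_imp_closed closed_Un)
  then have "connected_component (- (?C1 \<union> ?C2)) z y"
    by (metis (no_types, lifting) Compl_anti_mono Un_upper1 connected_component_of_subset
        connected_component_sym sup_mono)
  moreover have "z \<in> outside (?C1 \<union> ?C2)"
    using z outside_mono[of "?C1 \<union> ?C2"] by blast
  ultimately have "y \<in> outside (?C1 \<union> ?C2)"
    by (rule outside_same_component)
  with y show False
    using inside_Int_outside by blast
qed

text \<open>Two chords inside the closed curve \<open>c1 \<union> c2\<close> whose ends alternate along it must meet: the
  chord \<open>c3\<close> cuts the inside into two parts, and the closure of neither part contains points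
  of both \<open>c1\<close> and \<open>c2\<close> other than \<open>a\<close> and \<open>b\<close>.\<close>

lemma theta_crossing_arc:
  fixes c1 c2 c3 :: "real \<Rightarrow> complex"
  assumes c1: "arc c1" "pathstart c1 = a" "pathfinish c1 = b"
    and c2: "arc c2" "pathstart c2 = a" "pathfinish c2 = b"
    and c3: "arc c3" "pathstart c3 = a" "pathfinish c3 = b"
    and c12: "path_image c1 \<inter> path_image c2 = {a, b}"
    and c13: "path_image c1 \<inter> path_image c3 = {a, b}"
    and c23: "path_image c2 \<inter> path_image c3 = {a, b}"
    and c3in: "path_image c3 \<inter> inside (path_image c1 \<union> path_image c2) \<noteq> {}"
    and d: "arc d" "pathstart d \<in> path_image c1 - {a, b}" "pathfinish d \<in> path_image c2 - {a, b}"
      "path_image d \<inter> (path_image c1 \<union> path_image c2) \<subseteq> {pathstart d, pathfinish d}"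
      "path_image d \<inter> inside (path_image c1 \<union> path_image c2) \<noteq> {}"
  shows "path_image d \<inter> path_image c3 \<noteq> {}"
proof
  let ?C1 = "path_image c1" and ?C2 = "path_image c2" and ?C3 = "path_image c3"
  let ?I = "inside (?C1 \<union> ?C2)" and ?I1 = "inside (?C1 \<union> ?C3)" and ?I2 = "inside (?C2 \<union> ?C3)"
  assume disj: "path_image d \<inter> ?C3 = {}"
  let ?D = "path_image d - {pathstart d, pathfinish d}"
  have "a \<noteq> b" using c1 arc_distinct_ends by metis
  obtain ii: "?I1 \<inter> ?I2 = {}" and split: "?I1 \<union> ?I2 \<union> (?C3 - {a, b}) = ?I"
    using split_inside_simple_closed_curve[of c1 a b c2 c3] assms \<open>a \<noteq> b\<close>
    by (metis arc_imp_simple_path)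
  have cl: "closed (?C1 \<union> ?C3)" "closed (?C2 \<union> ?C3)" "closed (?C1 \<union> ?C2)"
    using c1 c2 c3 by (auto intro: closed_arc_image)
  have op: "open ?I1" "open ?I2" using cl by (auto intro: open_inside)
  have conD: "connected ?D"
    using d(1) by (intro connected_simple_path_endless arc_imp_simple_path)
  have DI: "?D \<inter> ?I \<noteq> {}"
    using d inside_no_overlap[of "?C1 \<union> ?C2"] by blast
  \<comment> \<open>The open arc stays on one side of the closed curve, and then in one of the two parts.\<close>
  have "?D \<inter> frontier ?I = {}"
    using frontier_inside_subset[OF cl(3)] d by blast
  then have "?D \<subseteq> ?I"
    using connected_Int_frontier[OF conD DI] by blast
  then have "?D \<subseteq> ?I1 \<union> ?I2" using split disj by blast
  then have "?D \<subseteq> ?I1 \<or> ?D \<subseteq> ?I2"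
    using connectedD[OF conD op] ii by blast
  moreover have ends: "{pathstart d, pathfinish d} \<subseteq> closure ?D"
  proof -
    have "d ` closure {0<..<1} \<subseteq> closure (d ` {0<..<1})"
      using d(1) by (intro image_closure_subset) (auto simp: arc_def path_def closure_subset)
    then show ?thesis
      unfolding simple_path_endless[OF arc_imp_simple_path[OF d(1)]]
      by (auto simp: pathstart_def pathfinish_def)
  qed
  moreover have "closure ?I1 \<subseteq> ?I1 \<union> (?C1 \<union> ?C3)" "closure ?I2 \<subseteq> ?I2 \<union> (?C2 \<union> ?C3)"
    using frontier_inside_subset[OF cl(1)] frontier_inside_subset[OF cl(2)] closure_Un_frontier by blast+
  ultimately have "pathfinish d \<in> ?I1 \<union> (?C1 \<union> ?C3) \<or> pathstart d \<in> ?I2 \<union> (?C2 \<union> ?C3)"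
    using closure_mono by blast
  moreover have "?I1 \<union> ?I2 \<subseteq> ?I" using split by blast
  ultimately show False
    using d inside_no_overlap[of "?C1 \<union> ?C2"] c12 c13 c23 by blast
qed

section \<open>Paths in drawings\<close>

fun path_edges :: "'a list \<Rightarrow> 'a set set" where
  "path_edges (x # y # xs) = insert {x, y} (path_edges (y # xs))"
| "path_edges _ = {}"

lemma path_edges_Cons:
  "path_edges (x # xs) = (if xs = [] then {} else insert {x, hd xs} (path_edges xs))"
  by (cases xs) auto

lemma path_edges_append:
  "path_edges (xs @ ys) = path_edges xs \<union> path_edges ys \<union>
     (if xs = [] \<or> ys = [] then {} else {{last xs, hd ys}})"
  by (induction xs rule: path_edges.induct) (auto simp: path_edges_Cons)

lemma path_edges_rev [simp]: "path_edges (rev xs) = path_edges xs"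
  by (induction xs)
    (auto simp: path_edges_append path_edges_Cons last_rev insert_commute)

lemma path_edges_split:
  "path_edges (xs @ y # zs) = path_edges (xs @ [y]) \<union> path_edges (y # zs)"
  by (auto simp: path_edges_append)

lemma path_edges_rev_inner:
  "path_edges (x # rev ys @ [z]) = path_edges (z # ys @ [x])"
  using path_edges_rev[of "z # ys @ [x]"] by simp

lemma path_edges_subset: "e \<in> path_edges xs \<Longrightarrow> e \<subseteq> set xs"
  by (induction xs rule: path_edges.induct) auto

lemma set_subset_Union_path_edges:
  "length xs \<ge> 2 \<Longrightarrow> set xs \<subseteq> \<Union> (path_edges xs)"
proof (induction xs rule: path_edges.induct)
  case (1 x y xs)
  then show ?case by (cases xs) auto
qed auto

text \<open>This makes internally disjoint paths with the same ends edge-disjoint unless both are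
  single edges.\<close>

lemma ends_notin_path_edges:
  assumes "distinct (a # us @ [b])" "us \<noteq> []"
  shows "{a, b} \<notin> path_edges (a # us @ [b])"
  using assms path_edges_subset[of _ us]
  by (auto simp: path_edges_Cons path_edges_append doubleton_eq_iff dest: hd_in_set)

lemma plane_drawing_Int:
  assumes "plane_drawing V E p D" "e \<in> E" "e' \<in> E" "e \<noteq> e'"
  shows "D e \<inter> D e' \<subseteq> p ` (e \<inter> e')"
  using assms by (simp add: plane_drawing_def)

lemma plane_drawing_eq_iff:
  assumes "plane_drawing V E p D" "x \<in> V" "y \<in> V"
  shows "p x = p y \<longleftrightarrow> x = y"
  using assms unfolding plane_drawing_def by (meson inj_on_eq_iff)

lemma plane_drawing_edge_arc:
  assumes "plane_drawing V E p D" "{x, y} \<in> E"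
  obtains g where "arc g" "path_image g = D {x, y}" "pathstart g = p x" "pathfinish g = p y"
proof -
  obtain g where g: "arc g" "path_image g = D {x, y}" "{pathstart g, pathfinish g} = {p x, p y}"
    using assms unfolding plane_drawing_def by (metis image_empty image_insert)
  show ?thesis
  proof (cases "pathstart g = p x")
    case True
    then show ?thesis using g that by (auto simp: doubleton_eq_iff)
  next
    case False
    then have "pathstart (reversepath g) = p x" "pathfinish (reversepath g) = p y"
      using g(3) by (auto simp: doubleton_eq_iff)
    then show ?thesis using g that[of "reversepath g"] by (auto simp: arc_reversepath)
  qed
qed

lemma plane_drawing_path_arc:
  assumes P: "plane_drawing V E p D"
  shows "\<lbrakk>path_edges xs \<subseteq> E; distinct xs; length xs \<ge> 2\<rbrakk> \<Longrightarrow>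
    \<exists>g. arc g \<and> path_image g = (\<Union>e\<in>path_edges xs. D e) \<and>
        pathstart g = p (hd xs) \<and> pathfinish g = p (last xs)"
proof (induction xs rule: path_edges.induct)
  case (1 x y zs)
  obtain g1 where g1: "arc g1" "path_image g1 = D {x, y}" "pathstart g1 = p x" "pathfinish g1 = p y"
    by (rule plane_drawing_edge_arc[OF P, of x y]) (use 1(2) in simp_all)
  show ?case
  proof (cases "zs = []")
    case True
    then show ?thesis using g1 by (intro exI[of _ g1]) simp
  next
    case False
    have "\<exists>g. arc g \<and> path_image g = (\<Union>e\<in>path_edges (y # zs). D e) \<and>
        pathstart g = p (hd (y # zs)) \<and> pathfinish g = p (last (y # zs))"
    proof (rule 1(1))
      show "path_edges (y # zs) \<subseteq> E" using 1(2) by simp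
      show "distinct (y # zs)" using 1(3) by simp
      show "2 \<le> length (y # zs)" using False by (cases zs) simp_all
    qed
    then obtain g2 where g2: "arc g2" "path_image g2 = (\<Union>e\<in>path_edges (y # zs). D e)"
        "pathstart g2 = p y" "pathfinish g2 = p (last (y # zs))" unfolding list.sel by blast
    have "D {x, y} \<inter> D e \<subseteq> {p y}" if e: "e \<in> path_edges (y # zs)" for e
    proof -
      have "x \<notin> e" using path_edges_subset[OF e] 1(3) by auto
      moreover have "D {x, y} \<inter> D e \<subseteq> p ` ({x, y} \<inter> e)"
      proof -
        have "{x, y} \<in> E" "e \<in> E" "{x, y} \<noteq> e" using e 1(2) \<open>x \<notin> e\<close> by auto
        then show ?thesis by (rule plane_drawing_Int[OF P])
      qed
      ultimately show ?thesis by blast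
    qed
    then have "path_image g1 \<inter> path_image g2 \<subseteq> {pathstart g2}"
      unfolding g1(2) g2(2,3) by blast
    then have "arc (g1 +++ g2)"
      using g1 g2 by (intro arc_join) simp_all
    moreover have "path_image (g1 +++ g2) = (\<Union>e\<in>path_edges (x # y # zs). D e)"
      using g1 g2 by (simp add: path_image_join)
    ultimately show ?thesis using g1 g2 by (intro exI[of _ "g1 +++ g2"]) simp
  qed
qed auto

lemma plane_drawing_vertex_on_path:
  assumes P: "plane_drawing V E p D" and xs: "path_edges xs \<subseteq> E" "length xs \<ge> 2" "v \<in> set xs"
  shows "p v \<in> (\<Union>e\<in>path_edges xs. D e)"
proof -
  obtain e where e: "e \<in> path_edges xs" "v \<in> e"
    using set_subset_Union_path_edges xs by blast
  then obtain g where g: "path_image g = D e" "{pathstart g, pathfinish g} = p ` e"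
    using P xs(1) unfolding plane_drawing_def by (meson subsetD)
  have "{pathstart g, pathfinish g} \<subseteq> path_image g"
    by (simp add: pathstart_in_path_image pathfinish_in_path_image)
  then have "p v \<in> D e" unfolding g using e(2) by blast
  then show ?thesis using e(1) by blast
qed

text \<open>A point on the boundary of the outer face is enclosed by no part of the drawing.\<close>

lemma not_inside_of_outer_point:
  fixes x :: complex
  assumes "closed S" "S \<subseteq> T" "x \<in> frontier (outside T)"
  shows "x \<notin> inside S"
proof -
  have "outside T \<inter> inside S = {}"
    using outside_mono[OF assms(2)] inside_Int_outside[of S] by blast
  then have "closure (outside T) \<inter> inside S = {}"
    using open_Int_closure_eq_empty[OF open_inside[OF assms(1)]] by blast
  then show ?thesis using assms(3) by (auto simp: frontier_def)
qed

text \<open>Three internally disjoint paths from \<open>a\<close> to \<open>b\<close>, given by their interior vertices.  The third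
  one may be a single edge: with \<open>ws = []\<close> the structure is a cycle with the chord \<open>{a, b}\<close>.\<close>

locale theta_in_graph =
  fixes V :: "'a set" and E :: "'a set set" and a b :: 'a and us vs ws :: "'a list"
  assumes graph: "simple_graph V E"
    and edges: "path_edges (a # us @ [b]) \<subseteq> E" "path_edges (a # vs @ [b]) \<subseteq> E"
      "path_edges (a # ws @ [b]) \<subseteq> E"
    and dist: "distinct (a # us @ vs @ ws @ [b])"
    and nonempty: "us \<noteq> []" "vs \<noteq> []"
begin

lemma theta_arcs:
  assumes P: "plane_drawing V E p D"
  obtains g1 g2 g3 where
    "arc g1" "pathstart g1 = p a" "pathfinish g1 = p b"
    "arc g2" "pathstart g2 = p a" "pathfinish g2 = p b"
    "arc g3" "pathstart g3 = p a" "pathfinish g3 = p b"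
    "path_image g1 = (\<Union>e\<in>path_edges (a # us @ [b]). D e)"
    "path_image g2 = (\<Union>e\<in>path_edges (a # vs @ [b]). D e)"
    "path_image g3 = (\<Union>e\<in>path_edges (a # ws @ [b]). D e)"
    "path_image g1 \<inter> path_image g2 = {p a, p b}"
    "path_image g1 \<inter> path_image g3 = {p a, p b}"
    "path_image g2 \<inter> path_image g3 = {p a, p b}"
proof -
  obtain g1 where g1: "arc g1" "pathstart g1 = p a" "pathfinish g1 = p b"
    "path_image g1 = (\<Union>e\<in>path_edges (a # us @ [b]). D e)"
    using plane_drawing_path_arc[OF P edges(1)] dist by auto
  obtain g2 where g2: "arc g2" "pathstart g2 = p a" "pathfinish g2 = p b"
    "path_image g2 = (\<Union>e\<in>path_edges (a # vs @ [b]). D e)"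
    using plane_drawing_path_arc[OF P edges(2)] dist by auto
  obtain g3 where g3: "arc g3" "pathstart g3 = p a" "pathfinish g3 = p b"
    "path_image g3 = (\<Union>e\<in>path_edges (a # ws @ [b]). D e)"
    using plane_drawing_path_arc[OF P edges(3)] dist by auto
  have meet: "(\<Union>e\<in>path_edges (a # xs @ [b]). D e) \<inter> (\<Union>e\<in>path_edges (a # ys @ [b]). D e) \<subseteq> {p a, p b}"
    if xs: "path_edges (a # xs @ [b]) \<subseteq> E" "xs \<noteq> []" and ys: "path_edges (a # ys @ [b]) \<subseteq> E"
      and d: "distinct (a # xs @ [b])" "set xs \<inter> set ys = {}" for xs ys
  proof -
    have "D e \<inter> D e' \<subseteq> {p a, p b}"
      if e: "e \<in> path_edges (a # xs @ [b])" and e': "e' \<in> path_edges (a # ys @ [b])" for e e'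
    proof -
      have sub: "e \<inter> e' \<subseteq> {a, b}"
        using path_edges_subset[OF e] path_edges_subset[OF e'] d by auto
      have "e \<noteq> e'"
      proof
        assume "e = e'"
        then have "e \<subseteq> {a, b}" using sub by simp
        moreover have "card e = 2" using graph xs(1) e unfolding simple_graph_def by blast
        ultimately have "e = {a, b}"
          by (intro card_seteq) (auto simp: card_insert_if)
        then show False using ends_notin_path_edges[OF d(1) xs(2)] e by simp
      qed
      moreover have "e \<in> E" "e' \<in> E" using e e' xs(1) ys(1) by blast+
      ultimately have "D e \<inter> D e' \<subseteq> p ` (e \<inter> e')"
        using plane_drawing_Int[OF P] by blast
      then show ?thesis using sub by blast
    qed
    then show ?thesis by blast
  qed
  have ends: "{p a, p b} \<subseteq> path_image g" if "pathstart g = p a" "pathfinish g = p b" for g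
    using that by (metis empty_subsetI insert_subset pathfinish_in_path_image pathstart_in_path_image)
  show thesis
  proof (rule that[OF g1(1-3) g2(1-3) g3(1-3) g1(4) g2(4) g3(4)])
    show "path_image g1 \<inter> path_image g2 = {p a, p b}"
      using meet[OF edges(1) nonempty(1) edges(2)] dist ends[of g1] ends[of g2] g1 g2 by auto
    show "path_image g1 \<inter> path_image g3 = {p a, p b}"
      using meet[OF edges(1) nonempty(1) edges(3)] dist ends[of g1] ends[of g3] g1 g3 by auto
    show "path_image g2 \<inter> path_image g3 = {p a, p b}"
      using meet[OF edges(2) nonempty(2) edges(3)] dist ends[of g2] ends[of g3] g2 g3 by auto
  qed
qed

lemma vertices: "set (a # us @ vs @ ws @ [b]) \<subseteq> V"
proof -
  have "set (a # xs @ [b]) \<subseteq> V" if "path_edges (a # xs @ [b]) \<subseteq> E" for xs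
  proof -
    have "set (a # xs @ [b]) \<subseteq> \<Union> (path_edges (a # xs @ [b]))"
      by (intro set_subset_Union_path_edges) simp
    then show ?thesis using that graph unfolding simple_graph_def by blast
  qed
  from this[OF edges(1)] this[OF edges(2)] this[OF edges(3)] show ?thesis by auto
qed

text \<open>If all vertices lie on the outer face, then interior vertices of the first two paths lie
  inside no closed curve of the drawing, so it is the third path that runs inside the
  other two.  For the same reason it has no interior vertex.\<close>

lemma third_path_inside:
  assumes P: "plane_drawing V E p D"
    and outer: "\<forall>v\<in>V. p v \<in> frontier (outside (p ` V \<union> (\<Union>e\<in>E. D e)))"
  shows "(\<Union>e\<in>path_edges (a # ws @ [b]). D e) \<inter>
    inside ((\<Union>e\<in>path_edges (a # us @ [b]). D e) \<union> (\<Union>e\<in>path_edges (a # vs @ [b]). D e)) \<noteq> {}"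
    and "ws = []"
proof -
  obtain g1 g2 g3 where
    g1: "arc g1" "pathstart g1 = p a" "pathfinish g1 = p b"
    and g2: "arc g2" "pathstart g2 = p a" "pathfinish g2 = p b"
    and g3: "arc g3" "pathstart g3 = p a" "pathfinish g3 = p b"
    and img: "path_image g1 = (\<Union>e\<in>path_edges (a # us @ [b]). D e)"
    "path_image g2 = (\<Union>e\<in>path_edges (a # vs @ [b]). D e)"
    "path_image g3 = (\<Union>e\<in>path_edges (a # ws @ [b]). D e)"
    and meet: "path_image g1 \<inter> path_image g2 = {p a, p b}"
    "path_image g1 \<inter> path_image g3 = {p a, p b}"
    "path_image g2 \<inter> path_image g3 = {p a, p b}"
    by (rule theta_arcs[OF P])
  have clo: "closed (path_image g1)" "closed (path_image g2)" "closed (path_image g3)"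
    using g1 g2 g3 by (auto intro: closed_arc_image)
  have sub: "path_image g1 \<union> path_image g2 \<union> path_image g3 \<subseteq> p ` V \<union> (\<Union>e\<in>E. D e)"
  proof -
    have "(\<Union>e\<in>F. D e) \<subseteq> p ` V \<union> (\<Union>e\<in>E. D e)" if "F \<subseteq> E" for F
      using that by blast
    from this[OF edges(1)] this[OF edges(2)] this[OF edges(3)] show ?thesis
      unfolding img by (intro Un_least)
  qed
  have outer': "p v \<notin> inside S" if "v \<in> V" "closed S" "S \<subseteq> path_image g1 \<union> path_image g2 \<union> path_image g3" for v S
    by (rule not_inside_of_outer_point[OF that(2) subset_trans[OF that(3) sub]]) (use that(1) outer in blast)
  have inj: "p x = p y \<longleftrightarrow> x = y" if "x \<in> V" "y \<in> V" for x y
    using plane_drawing_eq_iff[OF P that] .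
  have on: "p x \<in> (\<Union>e\<in>path_edges (a # xs @ [b]). D e)"
    if "x \<in> set xs" "path_edges (a # xs @ [b]) \<subseteq> E" for x xs
    by (rule plane_drawing_vertex_on_path[OF P that(2)]) (use that(1) in simp_all)
  have off: "x \<in> V \<and> p x \<notin> {p a, p b}" if "x \<in> set us \<union> set vs \<union> set ws" for x
  proof -
    have "x \<noteq> a" "x \<noteq> b" "x \<in> V" "a \<in> V" "b \<in> V" using that dist vertices by auto
    then show ?thesis using inj by blast
  qed
  have x1: "p (hd us) \<in> path_image g1" "p (hd us) \<notin> {p a, p b}"
    unfolding img using on[OF hd_in_set[OF nonempty(1)] edges(1)] off[of "hd us"] hd_in_set[OF nonempty(1)]
    by simp_all
  have x2: "p (hd vs) \<in> path_image g2" "p (hd vs) \<notin> {p a, p b}"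
    unfolding img using on[OF hd_in_set[OF nonempty(2)] edges(2)] off[of "hd vs"] hd_in_set[OF nonempty(2)]
    by simp_all
  have hdV: "hd us \<in> V" "hd vs \<in> V" using vertices nonempty by auto
  have meets: "path_image g3 \<inter> inside (path_image g1 \<union> path_image g2) \<noteq> {}"
    by (intro arc_meets_inside_of_theta[OF g1 g2 g3 meet x1 _ x2] outer' hdV closed_Un clo) blast+
  then show "(\<Union>e\<in>path_edges (a # ws @ [b]). D e) \<inter>
    inside ((\<Union>e\<in>path_edges (a # us @ [b]). D e) \<union> (\<Union>e\<in>path_edges (a # vs @ [b]). D e)) \<noteq> {}"
    by (simp add: img)
  show "ws = []"
  proof (rule ccontr)
    assume "ws \<noteq> []"
    then have x3: "p (hd ws) \<in> path_image g3" "p (hd ws) \<notin> {p a, p b}" "hd ws \<in> V"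
      unfolding img using on[OF hd_in_set edges(3)] off[of "hd ws"] hd_in_set[of ws] by simp_all
    let ?G = "path_image g3 - {pathstart g3, pathfinish g3}"
    let ?I = "inside (path_image g1 \<union> path_image g2)"
    have "connected ?G"
      using g3 by (intro connected_simple_path_endless arc_imp_simple_path)
    moreover have "?G \<inter> frontier ?I = {}"
      using frontier_inside_subset[OF closed_Un[OF clo(1,2)]] meet
      unfolding g3 by blast
    moreover have "?G \<inter> ?I \<noteq> {}"
    proof -
      obtain z where z: "z \<in> path_image g3" "z \<in> ?I" using meets by blast
      then have "z \<notin> path_image g1 \<union> path_image g2"
        using inside_no_overlap[of "path_image g1 \<union> path_image g2"] by (metis IntI empty_iff)
      then have "z \<notin> {p a, p b}" using meet(1) by (metis IntD1 UnI1)
      then show ?thesis unfolding g3 using z by blast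
    qed
    ultimately have "?G \<subseteq> ?I"
      by (metis connected_Int_frontier Diff_eq_empty_iff)
    then have "p (hd ws) \<in> ?I" using x3 unfolding g3 by blast
    moreover have "p (hd ws) \<notin> ?I"
      by (intro outer' x3(3) closed_Un clo) blast
    ultimately show False by blast
  qed
qed

end

text \<open>This is the exclusion of the subdivisions of the complete bipartite graph with parts of sizes two and
  three.\<close>

lemma outerplanar_no_theta:
  assumes "outerplanar V E" "theta_in_graph V E a b us vs ws"
  shows "ws = []"
proof -
  obtain p D where P: "plane_drawing V E p D"
    and outer: "\<forall>v\<in>V. p v \<in> frontier (outside (p ` V \<union> (\<Union>e\<in>E. D e)))"
    using assms(1) unfolding outerplanar_def by blast
  show ?thesis by (rule theta_in_graph.third_path_inside(2)[OF assms(2) P outer])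
qed

text \<open>This is the exclusion of the subdivisions of the complete graph on four vertices in which two
  disjoint edges remain undivided.  Both chords are drawn inside the cycle, where they would have
  to cross.\<close>

lemma outerplanar_no_crossing_chords:
  assumes O: "outerplanar V E" and G: "simple_graph V E"
    and d: "distinct (a # us @ b # vs)"
    and cycle: "path_edges (a # us @ b # vs @ [a]) \<subseteq> E"
    and ab: "{a, b} \<in> E" and cd: "{c, d} \<in> E" "c \<in> set us" "d \<in> set vs"
  shows False
proof -
  obtain p D where P: "plane_drawing V E p D"
    and outer: "\<forall>v\<in>V. p v \<in> frontier (outside (p ` V \<union> (\<Union>e\<in>E. D e)))"
    using O unfolding outerplanar_def by blast
  define A where "A xs = (\<Union>e\<in>path_edges xs. D e)" for xs
  obtain u1 u2 where us: "us = u1 @ c # u2" using cd by (meson split_list)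
  obtain v1 v2 where vs: "vs = v1 @ d # v2" using cd by (meson split_list)
  have "path_edges (a # us @ b # vs @ [a]) = path_edges (a # us @ [b]) \<union> path_edges (b # vs @ [a])"
    using path_edges_split[of "a # us" b "vs @ [a]"] by simp
  then have e2: "path_edges (a # us @ [b]) \<subseteq> E" "path_edges (a # rev vs @ [b]) \<subseteq> E"
    using cycle by (simp_all add: path_edges_rev_inner)
  \<comment> \<open>The cycle is also the union of the two paths that join \<open>c\<close> and \<open>d\<close>.\<close>
  have e4: "path_edges (a # us @ [b]) = path_edges (a # u1 @ [c]) \<union> path_edges (c # u2 @ [b])"
    "path_edges (a # rev vs @ [b]) = path_edges (b # v1 @ [d]) \<union> path_edges (d # v2 @ [a])"
    "path_edges (c # (u2 @ b # v1) @ [d]) = path_edges (c # u2 @ [b]) \<union> path_edges (b # v1 @ [d])"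
    "path_edges (c # (rev u1 @ a # rev v2) @ [d]) = path_edges (a # u1 @ [c]) \<union> path_edges (d # v2 @ [a])"
    using path_edges_split[of "a # u1" c "u2 @ [b]"] path_edges_split[of "b # v1" d "v2 @ [a]"]
      path_edges_split[of "c # u2" b "v1 @ [d]"] path_edges_split[of "c # rev u1" a "rev v2 @ [d]"]
      path_edges_rev_inner[of a vs b] path_edges_rev_inner[of c u1 a] path_edges_rev_inner[of a v2 d]
    by (simp_all add: us vs)
  interpret ab: theta_in_graph V E a b us "rev vs" "[]"
  proof
    show "path_edges (a # [] @ [b]) \<subseteq> E" using ab by simp
    show "distinct (a # us @ rev vs @ [] @ [b])" using d by auto
  qed (use G e2 cd in auto)
  interpret cd: theta_in_graph V E c d "u2 @ b # v1" "rev u1 @ a # rev v2" "[]"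
  proof
    show "path_edges (c # (u2 @ b # v1) @ [d]) \<subseteq> E" "path_edges (c # (rev u1 @ a # rev v2) @ [d]) \<subseteq> E"
      using e2 unfolding e4 by blast+
    show "path_edges (c # [] @ [d]) \<subseteq> E" using cd by simp
    show "distinct (c # (u2 @ b # v1) @ (rev u1 @ a # rev v2) @ [] @ [d])" using d us vs by auto
  qed (use G in auto)
  have un: "A (a # us @ [b]) \<union> A (a # rev vs @ [b]) =
      A (c # (u2 @ b # v1) @ [d]) \<union> A (c # (rev u1 @ a # rev v2) @ [d])"
    unfolding A_def e4 by blast
  have ab_in: "D {a, b} \<inter> inside (A (a # us @ [b]) \<union> A (a # rev vs @ [b])) \<noteq> {}"
    using ab.third_path_inside(1)[OF P outer] by (simp add: A_def)
  have cd_in: "D {c, d} \<inter> inside (A (a # us @ [b]) \<union> A (a # rev vs @ [b])) \<noteq> {}"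
    using cd.third_path_inside(1)[OF P outer] un by (simp add: A_def)
  obtain g1 g2 g3 where
    g1: "arc g1" "pathstart g1 = p a" "pathfinish g1 = p b"
    and g2: "arc g2" "pathstart g2 = p a" "pathfinish g2 = p b"
    and g3: "arc g3" "pathstart g3 = p a" "pathfinish g3 = p b"
    and img: "path_image g1 = (\<Union>e\<in>path_edges (a # us @ [b]). D e)"
    "path_image g2 = (\<Union>e\<in>path_edges (a # rev vs @ [b]). D e)"
    "path_image g3 = (\<Union>e\<in>path_edges (a # [] @ [b]). D e)"
    and meet: "path_image g1 \<inter> path_image g2 = {p a, p b}"
    "path_image g1 \<inter> path_image g3 = {p a, p b}"
    "path_image g2 \<inter> path_image g3 = {p a, p b}"
    by (rule ab.theta_arcs[OF P])
  obtain h where h: "arc h" "path_image h = D {c, d}" "pathstart h = p c" "pathfinish h = p d"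
    using plane_drawing_edge_arc[OF P cd(1)] by blast
  have inj: "p x = p y \<longleftrightarrow> x = y" if "x \<in> V" "y \<in> V" for x y
    using plane_drawing_eq_iff[OF P that] .
  have inV: "a \<in> V" "b \<in> V" "c \<in> V" "d \<in> V"
    using ab.vertices cd.vertices by auto
  have "path_image h \<inter> path_image g3 \<noteq> {}"
  proof (rule theta_crossing_arc[OF g1 g2 g3 meet])
    show "path_image g3 \<inter> inside (path_image g1 \<union> path_image g2) \<noteq> {}"
      using ab_in by (simp add: img A_def)
    show "path_image h \<inter> inside (path_image g1 \<union> path_image g2) \<noteq> {}"
      using cd_in by (simp add: img A_def h)
    show "arc h" by fact
    have "a \<noteq> c" "b \<noteq> c" "a \<noteq> d" "b \<noteq> d" using d cd by auto
    then show "pathstart h \<in> path_image g1 - {p a, p b}" "pathfinish h \<in> path_image g2 - {p a, p b}"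
      using plane_drawing_vertex_on_path[OF P ab.edges(1), of c]
        plane_drawing_vertex_on_path[OF P ab.edges(2), of d] cd inV inj
      by (auto simp: h img)
    have "D e \<inter> D {c, d} \<subseteq> {p c, p d}"
      if e: "e \<in> path_edges (a # us @ [b]) \<union> path_edges (a # rev vs @ [b])" for e
    proof -
      have "e \<noteq> {c, d}"
        using e path_edges_subset[of e] d cd by fastforce
      moreover have "e \<in> E" using e ab.edges by blast
      ultimately have "D e \<inter> D {c, d} \<subseteq> p ` (e \<inter> {c, d})"
        using plane_drawing_Int[OF P _ cd(1)] by blast
      then show ?thesis by blast
    qed
    then show "path_image h \<inter> (path_image g1 \<union> path_image g2) \<subseteq> {pathstart h, pathfinish h}"
      unfolding h img by blast
  qed
  moreover have "D {c, d} \<inter> D {a, b} \<subseteq> p ` ({c, d} \<inter> {a, b})"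
    using cd d by (intro plane_drawing_Int[OF P cd(1) ab]) (auto simp: doubleton_eq_iff)
  moreover have "{c, d} \<inter> {a, b} = {}" using d cd by auto
  ultimately show False by (simp add: h img)
qed

section \<open>Vertex orders without crossing edges\<close>

text \<open>Deleting parts of a drawing only enlarges its outer face.\<close>

lemma outerplanar_subgraph:
  assumes O: "outerplanar V E" and sub: "V' \<subseteq> V" "E' \<subseteq> E"
  shows "outerplanar V' E'"
proof -
  obtain p D where P: "plane_drawing V E p D"
    and outer: "\<forall>v\<in>V. p v \<in> frontier (outside (p ` V \<union> (\<Union>e\<in>E. D e)))"
    using O unfolding outerplanar_def by blast
  have "plane_drawing V' E' p D"
    using P sub unfolding plane_drawing_def by (meson inj_on_subset subsetD)
  moreover have "p v \<in> frontier (outside (p ` V' \<union> (\<Union>e\<in>E'. D e)))" if "v \<in> V'" for v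
  proof -
    let ?S = "p ` V' \<union> (\<Union>e\<in>E'. D e)"
    have "outside (p ` V \<union> (\<Union>e\<in>E. D e)) \<subseteq> outside ?S"
      using sub by (intro outside_mono) blast
    then have "p v \<in> closure (outside ?S)"
      using outer that sub closure_mono unfolding frontier_def by blast
    moreover have "p v \<in> ?S" using that by blast
    then have "p v \<notin> interior (outside ?S)"
      using interior_subset outside_no_overlap by (metis IntI empty_iff subsetD)
    ultimately show ?thesis by (simp add: frontier_def)
  qed
  ultimately show ?thesis unfolding outerplanar_def by blast
qed

lemma simple_graph_edgeD:
  assumes "simple_graph V E" "{u, v} \<in> E"
  shows "u \<in> V" "v \<in> V" "u \<noteq> v"
  using assms unfolding simple_graph_def by (auto simp: card_insert_if split: if_splits)

text \<open>Positions on a line such that the edges, drawn as arcs above it, do not cross (a book embedding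
  with one page).  Since \<open>{a, b}\<close> and \<open>{c, d}\<close> are unordered, the one pattern of inequalities
  covers every way in which the ends of two edges can alternate.\<close>

definition noncrossing :: "'a set set \<Rightarrow> ('a \<Rightarrow> nat) \<Rightarrow> bool" where
  "noncrossing E f \<longleftrightarrow>
     (\<forall>a b c d. {a, b} \<in> E \<longrightarrow> {c, d} \<in> E \<longrightarrow> \<not> (f a < f c \<and> f c < f b \<and> f b < f d))"

lemma noncrossingD:
  "\<lbrakk>noncrossing E f; {a, b} \<in> E; {c, d} \<in> E\<rbrakk> \<Longrightarrow> \<not> (f a < f c \<and> f c < f b \<and> f b < f d)"
  by (auto simp: noncrossing_def)

text \<open>Whether the ends of two edges alternate depends only on the cyclic order of the positions, so
  any vertex can be moved to the front by a rotation.\<close>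

lemma noncrossing_rotate:
  assumes G: "simple_graph V E" and f: "inj_on f V" "noncrossing E f"
  obtains g where "inj_on g V" "noncrossing E g" "\<And>x. x \<in> V \<Longrightarrow> g v \<le> g x"
proof -
  have "finite (f ` insert v V)" using G by (simp add: simple_graph_def)
  then obtain N where "\<forall>n\<in>f ` insert v V. n < N" by (meson finite_nat_set_iff_bounded)
  then have N: "f x < N" if "x = v \<or> x \<in> V" for x using that by blast
  define g where "g x = (if f x < f v then f x + N else f x)" for x
  show thesis
  proof
    show "inj_on g V"
      using f(1) N by (fastforce simp: inj_on_def g_def split: if_splits)
    show "g v \<le> g x" if "x \<in> V" for x
      using N[of v] by (auto simp: g_def)
    show "noncrossing E g"
      unfolding noncrossing_def
    proof (intro allI impI)
      fix a b c d assume e: "{a, b} \<in> E" "{c, d} \<in> E"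
      then have e': "{b, a} \<in> E" "{d, c} \<in> E" by (simp_all add: insert_commute)
      have V: "a \<in> V" "b \<in> V" "c \<in> V" "d \<in> V"
        using simple_graph_edgeD[OF G] e by blast+
      show "\<not> (g a < g c \<and> g c < g b \<and> g b < g d)"
      proof
        assume cross: "g a < g c \<and> g c < g b \<and> g b < g d"
        have step: "(f x < f v \<longrightarrow> f y < f v) \<and> ((f x < f v \<longleftrightarrow> f y < f v) \<longrightarrow> f x < f y)"
          if "g x < g y" "x \<in> V" "y \<in> V" for x y
          using that N[of x] N[of y] by (auto simp: g_def split: if_splits)
        have "\<not> (f a < f c \<and> f c < f b \<and> f b < f d)" "\<not> (f d < f a \<and> f a < f c \<and> f c < f b)"
          "\<not> (f b < f d \<and> f d < f a \<and> f a < f c)" "\<not> (f c < f b \<and> f b < f d \<and> f d < f a)"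
          using noncrossingD[OF f(2)] e e' by blast+
        with step[of a c] step[of c b] step[of b d] cross V show False
          by (cases "f a < f v"; cases "f c < f v"; cases "f b < f v"; cases "f d < f v") simp_all
      qed
    qed
  qed
qed

text \<open>A decomposition into two proper parts that share at most one vertex, namely \<open>v\<close>.  It covers
  disconnected graphs as well as graphs with a cut vertex, and a graph without one is either
  2-connected or a single edge or has at most one vertex.\<close>

definition separation :: "'a set \<Rightarrow> 'a set set \<Rightarrow> 'a set \<Rightarrow> 'a set \<Rightarrow> 'a \<Rightarrow> bool" where
  "separation V E V1 V2 v \<longleftrightarrow>
     V1 \<union> V2 = V \<and> V1 \<noteq> V \<and> V2 \<noteq> V \<and> V1 \<inter> V2 \<subseteq> {v} \<and> (\<forall>e\<in>E. e \<subseteq> V1 \<or> e \<subseteq> V2)"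

text \<open>If the shared vertex comes first in both orders, then placing the rest of \<open>V2\<close> behind all of
  \<open>V1\<close> creates no crossing: an edge of the first part lies entirely before the rest of the
  second part, and it cannot enclose the shared vertex.\<close>

lemma noncrossing_glue:
  assumes fin: "finite V1" and int: "V1 \<inter> V2 \<subseteq> {v}"
    and cover: "\<And>e. e \<in> E \<Longrightarrow> e \<subseteq> V1 \<or> e \<subseteq> V2"
    and f1: "inj_on f1 V1" "noncrossing {e\<in>E. e \<subseteq> V1} f1" "\<And>x. x \<in> V1 \<Longrightarrow> f1 v \<le> f1 x"
    and f2: "inj_on f2 V2" "noncrossing {e\<in>E. e \<subseteq> V2} f2" "\<And>x. x \<in> V2 \<Longrightarrow> f2 v \<le> f2 x"
  obtains g :: "'a \<Rightarrow> nat" where "inj_on g (V1 \<union> V2)" "noncrossing E g"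
proof -
  obtain N where "\<forall>n\<in>f1 ` V1. n < N"
    using fin by (meson finite_imageI finite_nat_set_iff_bounded)
  then have N: "f1 x < N" if "x \<in> V1" for x using that by blast
  define g where "g x = (if x \<in> V1 then f1 x else f2 x + N)" for x
  have g1: "g x = f1 x" "g x < N" if "x \<in> V1" for x
    using that N by (auto simp: g_def)
  have shared: "x = v" if "x \<in> V1" "x \<in> V2" for x using that int by blast
  \<comment> \<open>On the second part, the new order agrees with \<open>f2\<close>: a shared vertex is least in both.\<close>
  have g2: "g x < g y \<longleftrightarrow> f2 x < f2 y" if "x \<in> V2" "y \<in> V2" for x y
  proof -
    have "f2 v < f2 z" if "z \<in> V2" "z \<noteq> v" "v \<in> V2" for z
      using f2(1) f2(3)[OF that(1)] that by (metis inj_onD order_le_imp_less_or_eq)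
    moreover have "f1 v < N" if "v \<in> V1" using N that .
    ultimately show ?thesis
      using that shared unfolding g_def
      by (smt (verit) add_less_cancel_right le_add2 less_le_trans not_less_iff_gr_or_eq)
  qed
  have gN: "x = v" if "x \<in> V2" "g x < N" for x
    using that shared by (auto simp: g_def split: if_splits)
  show thesis
  proof
    show "inj_on g (V1 \<union> V2)"
    proof (rule inj_onI)
      fix x y assume xy: "x \<in> V1 \<union> V2" "y \<in> V1 \<union> V2" "g x = g y"
      then show "x = y"
        using f1(1) f2(1) N[of x] N[of y] by (auto simp: g_def inj_on_def split: if_splits)
    qed
    show "noncrossing E g"
      unfolding noncrossing_def
    proof (intro allI impI notI)
      fix a b c d
      assume e: "{a, b} \<in> E" "{c, d} \<in> E" and cross: "g a < g c \<and> g c < g b \<and> g b < g d"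
      consider "{a, b} \<subseteq> V1" "{c, d} \<subseteq> V1" | "{a, b} \<subseteq> V2" "{c, d} \<subseteq> V2"
        | "{a, b} \<subseteq> V1" "{c, d} \<subseteq> V2" | "{a, b} \<subseteq> V2" "{c, d} \<subseteq> V1"
        using cover e by blast
      then show False
      proof cases
        case 1
        then show False using noncrossingD[OF f1(2), of a b c d] e cross g1 by auto
      next
        case 2
        then show False using noncrossingD[OF f2(2), of a b c d] e cross g2 by auto
      next
        case 3
        then have "c = v" using gN[of c] g1(2)[of b] cross by auto
        moreover have "c \<in> V1 \<or> v \<notin> V1" using \<open>c = v\<close> by blast
        moreover have "g c < N" using g1(2)[of b] cross 3 by auto
        ultimately have "c \<in> V1" by (auto simp: g_def split: if_splits)
        then show False using \<open>c = v\<close> f1(3)[of a] g1 3 cross by auto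
      next
        case 4
        then have *: "g b < N" using g1(2)[of d] cross by auto
        then have "b = v" using gN 4 by auto
        moreover have "b \<in> V1" using * by (auto simp: g_def split: if_splits)
        ultimately show False using f1(3)[of c] g1 4 cross by auto
      qed
    qed
  qed
qed

text \<open>Cycles of length two are admitted: they are the single edges, traversed back and forth.\<close>

definition cycle :: "'a set set \<Rightarrow> 'a list \<Rightarrow> bool" where
  "cycle E xs \<longleftrightarrow> distinct xs \<and> length xs \<ge> 2 \<and> path_edges (xs @ [hd xs]) \<subseteq> E"

lemma cycle_rotate:
  assumes "cycle E (xs @ y # ys)"
  shows "cycle E (y # ys @ xs)"
proof (cases xs)
  case Nil
  then show ?thesis using assms by simp
next
  case (Cons x zs)
  have "path_edges ((x # zs) @ y # (ys @ [x])) \<subseteq> E"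
    using assms Cons by (simp add: cycle_def)
  then have "path_edges ((y # ys) @ x # (zs @ [y])) \<subseteq> E"
    using path_edges_split[of "x # zs" y "ys @ [x]"] path_edges_split[of "y # ys" x "zs @ [y]"] by simp
  then show ?thesis using assms Cons by (auto simp: cycle_def)
qed

lemma ex_distinct_path:
  assumes "(u, v) \<in> {(x, y). x \<in> W \<and> y \<in> W \<and> {x, y} \<in> E}\<^sup>*" "v \<in> W"
  shows "\<exists>xs. xs \<noteq> [] \<and> hd xs = u \<and> last xs = v \<and> distinct xs \<and> set xs \<subseteq> W \<and> path_edges xs \<subseteq> E"
  using assms(1)
proof (induction rule: converse_rtrancl_induct)
  case base
  show ?case using assms(2) by (intro exI[of _ "[v]"]) simp
next
  case (step x y)
  then obtain xs where xs: "xs \<noteq> []" "hd xs = y" "last xs = v" "distinct xs" "set xs \<subseteq> W"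
    "path_edges xs \<subseteq> E" by blast
  show ?case
  proof (cases "x \<in> set xs")
    case True
    then obtain as bs where "xs = as @ x # bs" by (meson split_list)
    then show ?thesis
      using xs path_edges_split[of as x bs] by (intro exI[of _ "x # bs"]) auto
  next
    case False
    then show ?thesis
      using xs step(1) by (intro exI[of _ "x # xs"]) (auto simp: path_edges_Cons)
  qed
qed

text \<open>Take a longest cycle.  If it misses a vertex, then some component \<open>K\<close> of its complement has
  two neighbours \<open>c\<close> and \<open>d\<close> on the cycle, for otherwise \<open>K\<close> could be separated from the rest at a
  single vertex.  A path from \<open>c\<close> to \<open>d\<close> through \<open>K\<close> makes the cycle longer when \<open>c\<close> and \<open>d\<close> are
  consecutive, and it forms a forbidden theta with the two halves of the cycle when they are
  not.\<close>

lemma ex_Hamiltonian_cycle: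
  assumes G: "simple_graph V E" and O: "outerplanar V E" and ne: "E \<noteq> {}"
    and nosep: "\<And>V1 V2 v. \<not> separation V E V1 V2 v"
  obtains xs where "cycle E xs" "set xs = V"
proof -
  have subV: "set xs \<subseteq> V" if "cycle E xs" for xs
  proof -
    have "set (xs @ [hd xs]) \<subseteq> \<Union> (path_edges (xs @ [hd xs]))"
      using that unfolding cycle_def by (intro set_subset_Union_path_edges) simp
    then show ?thesis using that G unfolding cycle_def simple_graph_def by auto
  qed
  obtain e where "e \<in> E" using ne by blast
  then obtain a b where "{a, b} \<in> E" "a \<noteq> b"
    using G unfolding simple_graph_def by (metis card_2_iff)
  \<comment> \<open>An edge counts as a cycle of length two, so that there is a longest cycle.\<close>
  then have "cycle E [a, b]" by (simp add: cycle_def insert_commute)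
  moreover have "length xs < Suc (card V)" if "cycle E xs" for xs
    using subV[OF that] that G unfolding cycle_def simple_graph_def
    by (metis card_mono distinct_card less_Suc_eq_le)
  ultimately obtain xs where xs: "cycle E xs" and max: "\<And>ys. cycle E ys \<Longrightarrow> length ys \<le> length xs"
    using ex_has_greatest_nat[of "cycle E" "[a, b]" length "Suc (card V)"] by blast
  have "set xs = V"
  proof (rule ccontr)
    assume "set xs \<noteq> V"
    then obtain x where x: "x \<in> V" "x \<notin> set xs" using subV[OF xs] by blast
    define W where "W = V - set xs"
    define R where "R = {(u, v). u \<in> W \<and> v \<in> W \<and> {u, v} \<in> E}"
    define K where "K = R\<^sup>* `` {x}"
    define N where "N = {c \<in> set xs. \<exists>k\<in>K. {c, k} \<in> E}"
    have "sym R" by (auto simp: R_def sym_def insert_commute)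
    then have symR: "(v, u) \<in> R\<^sup>*" if "(u, v) \<in> R\<^sup>*" for u v
      using that by (meson symD sym_rtrancl)
    have xK: "x \<in> K" by (simp add: K_def)
    have KW: "K \<subseteq> W"
    proof
      fix k assume "k \<in> K"
      then have "(x, k) \<in> R\<^sup>*" by (simp add: K_def)
      then show "k \<in> W" by (induction rule: rtrancl_induct) (use x in \<open>auto simp: W_def R_def\<close>)
    qed
    have closed: "w \<in> K" if "k \<in> K" "{k, w} \<in> E" "w \<in> W" for k w
    proof -
      have "(k, w) \<in> R" using that KW by (auto simp: R_def)
      then show ?thesis using that(1) unfolding K_def by (auto intro: rtrancl_into_rtrancl)
    qed
    have "\<not> N \<subseteq> {v}" for v
    proof
      assume Nv: "N \<subseteq> {v}"
      have "separation V E (K \<union> N) (V - K) v"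
        unfolding separation_def
      proof (intro conjI ballI)
        show "K \<union> N \<union> (V - K) = V" using KW subV[OF xs] by (auto simp: N_def W_def)
        show "V - K \<noteq> V" using x xK by blast
        show "(K \<union> N) \<inter> (V - K) \<subseteq> {v}" using Nv by blast
        show "K \<union> N \<noteq> V"
        proof
          assume "K \<union> N = V"
          then have "set xs \<subseteq> {v}" using KW Nv subV[OF xs] by (auto simp: W_def)
          then have "card (set xs) \<le> 1" using card_mono[of "{v}" "set xs"] by simp
          then show False using xs distinct_card[of xs] by (simp add: cycle_def)
        qed
        fix e assume e: "e \<in> E"
        then obtain u w where uw: "e = {u, w}" "u \<in> V" "w \<in> V"
          using G unfolding simple_graph_def by (metis card_2_iff insert_subset)
        have "w \<in> K \<union> N" if "u \<in> K" "{u, w} \<in> E" "w \<in> V" for u w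
          using closed[OF that(1,2)] that by (auto simp: W_def N_def insert_commute)
        from this[of u w] this[of w u] show "e \<subseteq> K \<union> N \<or> e \<subseteq> V - K"
          using e uw by (auto simp: insert_commute)
      qed
      then show False using nosep by blast
    qed
    then obtain c d where cd: "c \<in> N" "d \<in> N" "c \<noteq> d" by (metis singletonI subsetI)
    obtain k l where kl: "k \<in> K" "{c, k} \<in> E" "l \<in> K" "{d, l} \<in> E"
      using cd unfolding N_def by blast
    have "(k, x) \<in> R\<^sup>*" "(x, l) \<in> R\<^sup>*" using kl symR by (auto simp: K_def)
    then have "(k, l) \<in> R\<^sup>*" by (rule rtrancl_trans)
    then obtain ys where ys: "ys \<noteq> []" "hd ys = k" "last ys = l" "distinct ys" "set ys \<subseteq> W"
      "path_edges ys \<subseteq> E"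
      using ex_distinct_path[of k l W E] kl KW unfolding R_def by blast
    have ear: "path_edges (c # ys @ [d]) \<subseteq> E"
      using ys kl by (auto simp: path_edges_Cons path_edges_append insert_commute)
    obtain pre rest where pr: "xs = pre @ c # rest"
      using cd unfolding N_def by (metis (mono_tags, lifting) mem_Collect_eq split_list)
    have "d \<in> set (rest @ pre)" using cd pr unfolding N_def by auto
    then obtain us vs where uv: "rest @ pre = us @ d # vs" by (meson split_list)
    have C: "cycle E (c # us @ d # vs)"
      using cycle_rotate[of E pre c rest] xs pr uv by simp
    have len: "length xs = length (c # us @ d # vs)"
      using pr arg_cong[OF uv, of length] by simp
    have setxs: "set xs = set (c # us @ d # vs)"
      using pr arg_cong[OF uv, of set] by auto
    have dist: "distinct (c # us @ d # vs)" using C by (simp add: cycle_def)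
    have dis: "set ys \<inter> set (c # us @ d # vs) = {}"
      using ys setxs by (auto simp: W_def)
    have arcs: "path_edges (c # us @ [d]) \<subseteq> E" "path_edges (d # vs @ [c]) \<subseteq> E"
      using C path_edges_split[of "c # us" d "vs @ [c]"] by (auto simp: cycle_def)
    have "us \<noteq> []"
    proof
      assume "us = []"
      then have "cycle E (c # ys @ d # vs)"
        using dist dis ys(4) ear arcs path_edges_split[of "c # ys" d "vs @ [c]"]
        by (auto simp: cycle_def)
      then show False using max len ys(1) \<open>us = []\<close> by fastforce
    qed
    moreover have "vs \<noteq> []"
    proof
      assume "vs = []"
      then have "cycle E (c # us @ d # rev ys)"
        using dist dis ys(4) ear arcs path_edges_split[of "c # us" d "rev ys @ [c]"]
        by (auto simp: cycle_def path_edges_rev_inner)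
      then show False using max len ys(1) \<open>vs = []\<close> by fastforce
    qed
    ultimately have "theta_in_graph V E c d us (rev vs) ys"
      using G arcs ear dist dis ys(4) by unfold_locales (auto simp: path_edges_rev_inner)
    then show False using outerplanar_no_theta[OF O] ys(1) by blast
  qed
  then show thesis using xs that by blast
qed

lemma noncrossing_along_Hamiltonian_cycle:
  assumes G: "simple_graph V E" and O: "outerplanar V E" and xs: "cycle E xs" "set xs = V"
  obtains f :: "'a \<Rightarrow> nat" where "inj_on f V" "noncrossing E f"
proof -
  define f where "f x = length (takeWhile (\<lambda>y. y \<noteq> x) xs)" for x
  have f: "f x < length xs" "xs ! f x = x" if "x \<in> V" for x
  proof -
    obtain as bs where "xs = as @ x # bs" "x \<notin> set as"
      using \<open>x \<in> V\<close> xs(2) by (metis split_list_first)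
    moreover from this have "takeWhile (\<lambda>y. y \<noteq> x) xs = as"
      by (auto simp: takeWhile_append)
    ultimately show "f x < length xs" "xs ! f x = x" by (simp_all add: f_def)
  qed
  have "inj_on f V" by (metis f(2) inj_onI)
  moreover have "noncrossing E f"
    unfolding noncrossing_def
  proof (intro allI impI notI)
    fix a b c d
    assume e: "{a, b} \<in> E" "{c, d} \<in> E" and cross: "f a < f c \<and> f c < f b \<and> f b < f d"
    have V: "a \<in> V" "b \<in> V" "c \<in> V" "d \<in> V" using simple_graph_edgeD[OF G] e by blast+
    define pre rest where "pre = take (f a) xs" and "rest = drop (Suc (f a)) xs"
    have xs1: "xs = pre @ a # rest"
      using id_take_nth_drop[OF f(1)[OF V(1)]] f(2)[OF V(1)] by (simp add: pre_def rest_def)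
    have rest: "rest ! (f x - Suc (f a)) = x \<and> f x - Suc (f a) < length rest" if "x \<in> V" "f a < f x" for x
      using f[OF that(1)] that(2) by (auto simp: rest_def)
    define k where "k = f b - Suc (f a)"
    define us vs where "us = take k rest" and "vs = drop (Suc k) rest"
    have kb: "k < length rest" "rest ! k = b" using rest[of b] V cross by (auto simp: k_def)
    then have rest1: "rest = us @ b # vs"
      using id_take_nth_drop[OF kb(1)] by (simp add: us_def vs_def)
    have "c \<in> set us"
    proof -
      have "f c - Suc (f a) < k" using cross by (auto simp: k_def)
      then show ?thesis
        unfolding us_def in_set_conv_nth using rest[of c] V cross kb
        by (intro exI[of _ "f c - Suc (f a)"]) auto
    qed
    moreover have "d \<in> set (vs @ pre)"
    proof -
      have idx: "f d - Suc (f a) = Suc k + (f d - Suc (f b))"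
        using cross unfolding k_def by arith
      have "rest ! (Suc k + (f d - Suc (f b))) = d" "Suc k + (f d - Suc (f b)) < length rest"
        using rest[of d] V cross unfolding idx by auto
      then have "d = vs ! (f d - Suc (f b))" "f d - Suc (f b) < length vs"
        using kb unfolding vs_def by (auto simp: nth_drop)
      then show ?thesis by (metis UnCI nth_mem set_append)
    qed
    moreover have "cycle E (a # us @ b # vs @ pre)"
      using cycle_rotate[of E pre a rest] xs(1) xs1 rest1 by simp
    then have "distinct (a # us @ b # (vs @ pre))" "path_edges (a # us @ b # (vs @ pre) @ [a]) \<subseteq> E"
      by (auto simp: cycle_def)
    ultimately show False using outerplanar_no_crossing_chords[OF O G] e by blast
  qed
  ultimately show thesis using that by blast
qed

text \<open>The combinatorial content of outerplanarity.  A graph with a separation is glued from its two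
  parts; without a separation it has a Hamiltonian cycle, whose vertex order has no crossing.\<close>

theorem outerplanar_imp_noncrossing:
  assumes "simple_graph V E" "outerplanar V E"
  shows "\<exists>f :: 'a \<Rightarrow> nat. inj_on f V \<and> noncrossing E f"
  using assms
proof (induction "card V" arbitrary: V E rule: less_induct)
  case less
  have fin: "finite V" using less.prems by (simp add: simple_graph_def)
  show ?case
  proof (cases "\<exists>V1 V2 v. separation V E V1 V2 v")
    case True
    then obtain V1 V2 v where sep: "separation V E V1 V2 v" by blast
    then have un: "V1 \<union> V2 = V" and ne: "V1 \<noteq> V" "V2 \<noteq> V" and int: "V1 \<inter> V2 \<subseteq> {v}"
      by (simp_all add: separation_def)
    have cover: "e \<subseteq> V1 \<or> e \<subseteq> V2" if "e \<in> E" for e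
      using sep that by (simp add: separation_def)
    have part: "\<exists>f :: 'a \<Rightarrow> nat. inj_on f U \<and> noncrossing {e\<in>E. e \<subseteq> U} f \<and> (\<forall>x\<in>U. f v \<le> f x)"
      if U: "U \<subseteq> V" "U \<noteq> V" for U
    proof -
      have S: "simple_graph U {e\<in>E. e \<subseteq> U}"
        using less.prems(1) U by (auto simp: simple_graph_def intro: finite_subset)
      have "outerplanar U {e\<in>E. e \<subseteq> U}"
        using less.prems(2) U by (auto intro: outerplanar_subgraph)
      moreover have "card U < card V" using U fin by (simp add: psubset_card_mono psubset_eq)
      ultimately obtain f :: "'a \<Rightarrow> nat" where f: "inj_on f U" "noncrossing {e\<in>E. e \<subseteq> U} f"
        using less.hyps[OF _ S] by blast
      show ?thesis
        by (rule noncrossing_rotate[OF S f, of v]) blast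
    qed
    have U: "V1 \<subseteq> V" "V2 \<subseteq> V" using un by auto
    obtain f1 :: "'a \<Rightarrow> nat"
      where f1: "inj_on f1 V1" "noncrossing {e\<in>E. e \<subseteq> V1} f1" "\<forall>x\<in>V1. f1 v \<le> f1 x"
      using part[OF U(1) ne(1)] by (elim exE conjE)
    obtain f2 :: "'a \<Rightarrow> nat"
      where f2: "inj_on f2 V2" "noncrossing {e\<in>E. e \<subseteq> V2} f2" "\<forall>x\<in>V2. f2 v \<le> f2 x"
      using part[OF U(2) ne(2)] by (elim exE conjE)
    obtain g :: "'a \<Rightarrow> nat" where "inj_on g (V1 \<union> V2)" "noncrossing E g"
      by (rule noncrossing_glue[OF finite_subset[OF U(1) fin] int cover f1(1,2) bspec[OF f1(3)]
            f2(1,2) bspec[OF f2(3)]])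
    then show ?thesis using un by blast
  next
    case False
    show ?thesis
    proof (cases "E = {}")
      case True
      then show ?thesis
        using finite_imp_inj_to_nat_seg[OF fin] by (auto simp: noncrossing_def)
    next
      case False
      have nosep: "\<not> separation V E V1 V2 v" for V1 V2 v
        using \<open>\<nexists>V1 V2 v. separation V E V1 V2 v\<close> by blast
      obtain xs where xs: "cycle E xs" "set xs = V"
        by (rule ex_Hamiltonian_cycle[OF less.prems False nosep])
      obtain f :: "'a \<Rightarrow> nat" where "inj_on f V" "noncrossing E f"
        by (rule noncrossing_along_Hamiltonian_cycle[OF less.prems xs])
      then show ?thesis by blast
    qed
  qed
qed

section \<open>Leveled drawings of breadth first layers\<close>

lemma ex_upward_edge:
  assumes G: "simple_graph V E" and e: "e \<in> E"
    and level: "\<And>u v. {u, v} \<in> E \<Longrightarrow> d v = Suc (d u) \<or> d u = Suc (d v)"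
  obtains u v where "e = {u, v}" "u \<in> V" "v \<in> V" "d v = Suc (d u)"
proof -
  obtain x y where xy: "e = {x, y}" using G e unfolding simple_graph_def by (meson card_2_iff)
  then have V: "x \<in> V" "y \<in> V" using simple_graph_edgeD[OF G] e by blast+
  consider "d y = Suc (d x)" | "d x = Suc (d y)" using level[of x y] e xy by blast
  then show thesis
  proof cases
    case 1
    then show thesis using that[OF xy V] by simp
  next
    case 2
    then show thesis using that[of y x] xy V by (simp add: insert_commute)
  qed
qed

text \<open>With heights \<open>d\<close> and horizontal positions \<open>h\<close>, segments in different strips can meet only on
  the level between the strips, and two segments in the same strip can meet only at a common end
  unless their lower and upper ends are in opposite orders.\<close>

lemma leveled_planar_drawing_by_order:
  fixes d h :: "'a \<Rightarrow> nat"
  assumes G: "simple_graph V E" and inj: "inj_on h V"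
    and level: "\<And>u v. {u, v} \<in> E \<Longrightarrow> d v = Suc (d u) \<or> d u = Suc (d v)"
    and mono: "\<And>u v u' v'. \<lbrakk>{u, v} \<in> E; {u', v'} \<in> E; d u' = d u; d v = Suc (d u); d v' = Suc (d u);
      h u < h u'\<rbrakk> \<Longrightarrow> h v \<le> h v'"
  shows "\<exists>p. leveled_planar_drawing V E (\<lambda>i. {v \<in> V. d v = i}) p"
proof -
  define p where "p v = Complex (real (h v)) (real (d v))" for v
  have hull: "convex hull (p ` {u, v}) = closed_segment (p u) (p v)" for u v
    by (simp add: segment_convex_hull)
  have peq: "p u = p v \<longleftrightarrow> u = v" if "u \<in> V" "v \<in> V" for u v
    using inj that by (auto simp: p_def inj_on_def)
  have pt: "\<exists>t::real. 0 \<le> t \<and> t \<le> 1 \<and> Im z = d u + t \<and> Re z = (1 - t) * h u + t * h v"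
    if z: "z \<in> closed_segment (p u) (p v)" and up: "d v = Suc (d u)" for u v z
  proof -
    obtain t where t: "0 \<le> t" "t \<le> 1" "z = (1 - t) *\<^sub>R p u + t *\<^sub>R p v"
      using z unfolding in_segment by blast
    have "Re z = (1 - t) * h u + t * h v" "Im z = (1 - t) * d u + t * d v"
      unfolding t(3) p_def by simp_all
    moreover have "(1 - t) * d u + t * d v = d u + t"
      unfolding up by (simp add: algebra_simps)
    ultimately show ?thesis using t(1,2) by (intro exI[of _ t]) simp
  qed
  have up: "\<exists>u v. e = {u, v} \<and> u \<in> V \<and> v \<in> V \<and> d v = Suc (d u)" if "e \<in> E" for e
    by (rule ex_upward_edge[OF G that level]) auto
  have meet: "z \<in> p ` ({u, v} \<inter> {u', v'})"
    if e: "{u, v} \<in> E" "{u', v'} \<in> E" "{u, v} \<noteq> {u', v'}" and ups: "d v = Suc (d u)" "d v' = Suc (d u')"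
      and z: "z \<in> closed_segment (p u) (p v)" "z \<in> closed_segment (p u') (p v')"
      and le: "d u < d u' \<or> d u = d u' \<and> h u \<le> h u'" for u v u' v' z
  proof -
    have V: "u \<in> V" "v \<in> V" "u' \<in> V" "v' \<in> V" using simple_graph_edgeD[OF G] e by blast+
    obtain t :: real where t: "0 \<le> t" "t \<le> 1" "Im z = d u + t" "Re z = (1 - t) * h u + t * h v"
      using pt[OF z(1) ups(1)] by blast
    obtain t' :: real where t': "0 \<le> t'" "t' \<le> 1" "Im z = d u' + t'" "Re z = (1 - t') * h u' + t' * h v'"
      using pt[OF z(2) ups(2)] by blast
    show ?thesis
    proof (cases "d u = d u'")
      case False
      then have "d u < d u'" using le by simp
      then have "real (d u) + 1 \<le> real (d u')" by linarith
      then have 1: "t = 1" "t' = 0" "real (d u') = real (d u) + 1" using t t' by linarith+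
      then have "z = p v" "z = p u'" using t t' ups by (auto simp: p_def complex_eq_iff)
      then have "v = u'" using peq V by metis
      then show ?thesis using \<open>z = p v\<close> by auto
    next
      case True
      then have tt: "t' = t" using t t' by simp
      have eq: "(1 - t) * (real (h u') - real (h u)) + t * (real (h v') - real (h v)) = 0"
        using t(4) t'(4) tt by (simp add: algebra_simps)
      show ?thesis
      proof (cases "u = u'")
        case same: True
        then have "v \<noteq> v'" using e(3) by auto
        then have "h v \<noteq> h v'" using inj V by (auto simp: inj_on_def)
        then have "t = 0" using eq same by simp
        then have "z = p u" using t by (simp add: p_def complex_eq_iff)
        then show ?thesis using same by auto
      next
        case diff: False
        then have "h u \<noteq> h u'" using inj V by (auto simp: inj_on_def)
        then have less: "h u < h u'" using le True by simp
        then have "h v \<le> h v'" using mono[OF e(1,2)] True ups by simp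
        then have "t * (real (h v') - real (h v)) \<ge> 0" using t by simp
        moreover have "(1 - t) * (real (h u') - real (h u)) \<ge> 0" using t less by simp
        ultimately have "(1 - t) * (real (h u') - real (h u)) = 0" "t * (real (h v') - real (h v)) = 0"
          using eq by linarith+
        then have "t = 1" "h v' = h v" using less by auto
        then have "v = v'" "z = p v" using inj V t ups by (auto simp: p_def complex_eq_iff inj_on_def)
        then show ?thesis by auto
      qed
    qed
  qed
  have plane: "plane_drawing V E p (\<lambda>e. convex hull (p ` e))"
    unfolding plane_drawing_def
  proof (intro conjI ballI impI)
    show "inj_on p V" using peq by (auto simp: inj_on_def)
  next
    fix e assume "e \<in> E"
    then obtain u v where uv: "e = {u, v}" "u \<in> V" "v \<in> V" "d v = Suc (d u)"
      using up by blast
    then have "arc (linepath (p u) (p v))" using peq by (intro arc_linepath) auto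
    then show "\<exists>g. arc g \<and> path_image g = convex hull (p ` e) \<and> {pathstart g, pathfinish g} = p ` e"
      unfolding uv(1) hull by (intro exI[of _ "linepath (p u) (p v)"]) simp
  next
    fix e w assume "e \<in> E" and w: "w \<in> V" "p w \<in> convex hull (p ` e)"
    then obtain u v where uv: "e = {u, v}" "u \<in> V" "v \<in> V" "d v = Suc (d u)"
      using up by blast
    then obtain t :: real where t: "0 \<le> t" "t \<le> 1" "real (d w) = d u + t" "real (h w) = (1 - t) * h u + t * h v"
      using pt[of "p w" u v] w(2) unfolding uv(1) hull by (auto simp: p_def)
    then have "d w = d u \<or> d w = Suc (d u)" by linarith
    then have "t = 0 \<or> t = 1" using t(3) by auto
    then have "h w = h u \<or> h w = h v" using t(4) by auto
    then show "w \<in> e" using inj w(1) uv by (auto simp: inj_on_def)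
  next
    fix e e' assume e: "e \<in> E" "e' \<in> E" "e \<noteq> e'"
    obtain u v where uv: "e = {u, v}" "u \<in> V" "v \<in> V" "d v = Suc (d u)"
      using up[OF e(1)] by blast
    obtain u' v' where uv': "e' = {u', v'}" "u' \<in> V" "v' \<in> V" "d v' = Suc (d u')"
      using up[OF e(2)] by blast
    consider "d u < d u' \<or> d u = d u' \<and> h u \<le> h u'" | "d u' < d u \<or> d u' = d u \<and> h u' \<le> h u"
      by linarith
    then show "convex hull (p ` e) \<inter> convex hull (p ` e') \<subseteq> p ` (e \<inter> e')"
    proof cases
      case 1
      show ?thesis
        using meet[of u v u' v', OF _ _ _ uv(4) uv'(4) _ _ 1] e unfolding uv(1) uv'(1) hull by blast
    next
      case 2
      show ?thesis
        using meet[of u' v' u v, OF _ _ _ uv'(4) uv(4) _ _ 2] e unfolding uv(1) uv'(1) hull by blast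
    qed
  qed
  have "leveled_planar_drawing V E (\<lambda>i. {v \<in> V. d v = i}) p"
    unfolding leveled_planar_drawing_def
  proof (intro conjI ballI)
    show "sequence_partition V (\<lambda>i. {v \<in> V. d v = i})"
      by (auto simp: sequence_partition_def disjoint_family_on_def)
  next
    fix e assume "e \<in> E"
    then obtain u v where "e = {u, v}" "u \<in> V" "v \<in> V" "d v = Suc (d u)"
      using up by blast
    then show "\<exists>u v i. e = {u, v} \<and> u \<in> {v \<in> V. d v = i} \<and> v \<in> {v \<in> V. d v = Suc i}"
      by blast
  next
    show "\<exists>n c. n \<noteq> 0 \<and> strict_mono (c :: nat \<Rightarrow> real) \<and> (\<forall>i. \<forall>v\<in>{v \<in> V. d v = i}. p v \<bullet> n = c i)"
      by (intro exI[of _ \<i>] exI[of _ real]) (auto simp: strict_mono_def p_def inner_complex_def)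
  qed (fact plane)
  then show ?thesis by blast
qed

text \<open>The ends of a chord separate the vertices between them from all others: an edge that leads past
  them would cross the chord.\<close>

lemma walk_into_chord:
  assumes G: "simple_graph V E" and f: "inj_on f V" "noncrossing E f"
    and uv: "{u, v} \<in> E" and r: "\<not> (f u < f r \<and> f r < f v)"
  shows "\<lbrakk>(r, x) \<in> adj E ^^ n; f u < f x; f x < f v\<rbrakk> \<Longrightarrow>
    \<exists>m<n. (r, u) \<in> adj E ^^ m \<or> (r, v) \<in> adj E ^^ m"
proof (induction n arbitrary: x)
  case 0
  then show ?case using r by simp
next
  case (Suc n)
  obtain y where y: "(r, y) \<in> adj E ^^ n" "(y, x) \<in> adj E" using Suc.prems(1) by auto
  then have e: "{y, x} \<in> E" "{x, y} \<in> E" by (simp_all add: adj_def insert_commute)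
  show ?case
  proof (cases "f u < f y \<and> f y < f v")
    case True
    then show ?thesis using Suc.IH[OF y(1)] less_Suc_eq by blast
  next
    case False
    have "\<not> f y < f u" using noncrossingD[OF f(2) e(1) uv] Suc.prems by auto
    moreover have "\<not> f v < f y" using noncrossingD[OF f(2) uv e(2)] Suc.prems by auto
    ultimately have "f y = f u \<or> f y = f v" using False by linarith
    then have "y = u \<or> y = v"
      using f(1) simple_graph_edgeD[OF G e(1)] simple_graph_edgeD[OF G uv] by (auto simp: inj_on_def)
    then show ?thesis using y(1) by blast
  qed
qed

lemma graph_dist_walk:
  assumes "(r, v) \<in> (adj E)\<^sup>*"
  shows "(r, v) \<in> adj E ^^ graph_dist E r v"
proof -
  obtain n where "(r, v) \<in> adj E ^^ n" using assms rtrancl_imp_relpow by blast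
  then show ?thesis unfolding graph_dist_def by (rule LeastI)
qed

lemma graph_dist_le: "(r, v) \<in> adj E ^^ n \<Longrightarrow> graph_dist E r v \<le> n"
  unfolding graph_dist_def by (rule Least_le)

text \<open>The distances of adjacent vertices differ by at most one, and in a bipartite graph they have
  different parity.\<close>

lemma bipartite_graph_dist_edge:
  assumes G: "simple_graph V E" and bip: "bipartite V E" and e: "{u, v} \<in> E"
    and u: "(r, u) \<in> (adj E)\<^sup>*"
  shows "graph_dist E r v = Suc (graph_dist E r u) \<or> graph_dist E r u = Suc (graph_dist E r v)"
proof -
  have uv: "(u, v) \<in> adj E" "(v, u) \<in> adj E" using e by (simp_all add: adj_def insert_commute)
  then have v: "(r, v) \<in> (adj E)\<^sup>*" using u by (meson rtrancl.rtrancl_into_rtrancl)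
  obtain A B where AB: "A \<inter> B = {}" "\<forall>e\<in>E. \<exists>a\<in>A. \<exists>b\<in>B. e = {a, b}"
    using bip unfolding bipartite_def by blast
  have side: "x \<in> A \<longleftrightarrow> y \<notin> A" if "(x, y) \<in> adj E" for x y
    using AB that unfolding adj_def by (fastforce simp: doubleton_eq_iff)
  have parity: "x \<in> A \<longleftrightarrow> (r \<in> A \<longleftrightarrow> even n)" if "(r, x) \<in> adj E ^^ n" for x n
    using that by (induction n arbitrary: x) (use side in auto)
  have "even (graph_dist E r u) \<noteq> even (graph_dist E r v)"
    using parity[OF graph_dist_walk[OF u]] parity[OF graph_dist_walk[OF v]] side[OF uv(1)] by blast
  then have "graph_dist E r u \<noteq> graph_dist E r v" by metis
  then show ?thesis
    using graph_dist_step[OF u uv(1)] graph_dist_step[OF v uv(2)] by linarith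
qed

text \<open>Here \<open>\<rho>\<close> assigns to each vertex the root of its component, so that connected and disconnected
  graphs are treated alike; the components are drawn side by side.  Within a component, let two
  edges between layers \<open>i\<close> and \<open>i + 1\<close> be in opposite order at their ends.  Since they do not
  cross, the end in layer \<open>i\<close> of one of them lies strictly between the ends of the other.  The root
  is first in the order, so it reaches this vertex only through one of those ends, which puts the
  vertex at distance more than \<open>i\<close>.\<close>

lemma leveled_planar_drawing_from_roots:
  fixes f :: "'a \<Rightarrow> nat"
  assumes G: "simple_graph V E" and bip: "bipartite V E" and f: "inj_on f V" "noncrossing E f"
    and root: "\<And>v. v \<in> V \<Longrightarrow> (\<rho> v, v) \<in> (adj E)\<^sup>*" "\<And>u v. {u, v} \<in> E \<Longrightarrow> \<rho> u = \<rho> v"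
      "\<And>v. v \<in> V \<Longrightarrow> f (\<rho> v) \<le> f v"
  shows "\<exists>p. leveled_planar_drawing V E (\<lambda>i. {v \<in> V. graph_dist E (\<rho> v) v = i}) p"
proof -
  have rootV: "\<rho> v \<in> V" if "v \<in> V" for v
    using root(1)[OF that] that
    by (induction rule: converse_rtrancl_induct) (use simple_graph_edgeD[OF G] in \<open>auto simp: adj_def\<close>)
  let ?d = "\<lambda>v. graph_dist E (\<rho> v) v"
  have "finite (f ` V)" using G by (simp add: simple_graph_def)
  then obtain N where "\<forall>n\<in>f ` V. n < N" by (meson finite_nat_set_iff_bounded)
  then have N: "f x < N" if "x \<in> V" for x using that by blast
  \<comment> \<open>The lexicographic order of the pairs \<open>(f (\<rho> v), f v)\<close>, encoded in one number.\<close>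
  define h where "h v = f (\<rho> v) * N + f v" for v
  have hmod: "h v mod N = f v" and hdiv: "h v div N = f (\<rho> v)" if "v \<in> V" for v
    using N[OF that] by (simp_all add: h_def)
  have nested: "?d s < ?d x \<or> ?d t < ?d x"
    if st: "{s, t} \<in> E" and x: "x \<in> V" "\<rho> x = \<rho> s" and between: "f s < f x" "f x < f t" for s t x
  proof -
    have V: "s \<in> V" using simple_graph_edgeD[OF G st] by blast
    have "\<not> (f s < f (\<rho> x) \<and> f (\<rho> x) < f t)" using root(3)[OF V] x by auto
    from walk_into_chord[OF G f st this graph_dist_walk[OF root(1)[OF x(1)]] between]
    obtain m where "m < ?d x" "(\<rho> x, s) \<in> adj E ^^ m \<or> (\<rho> x, t) \<in> adj E ^^ m" by blast
    then show ?thesis using x(2) root(2)[OF st] graph_dist_le by (metis le_less_trans)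
  qed
  show ?thesis
  proof (rule leveled_planar_drawing_by_order[OF G])
    show "inj_on h V" using hmod f(1) by (metis inj_on_def)
    show "?d v = Suc (?d u) \<or> ?d u = Suc (?d v)" if "{u, v} \<in> E" for u v
      using bipartite_graph_dist_edge[OF G bip that root(1)] simple_graph_edgeD[OF G that] root(2)[OF that]
      by simp
    fix u v u' v'
    assume e: "{u, v} \<in> E" "{u', v'} \<in> E"
      and d: "?d u' = ?d u" "?d v = Suc (?d u)" "?d v' = Suc (?d u)" and less: "h u < h u'"
    have V: "u \<in> V" "v \<in> V" "u' \<in> V" "v' \<in> V" using simple_graph_edgeD[OF G] e by blast+
    have \<rho>: "\<rho> v = \<rho> u" "\<rho> v' = \<rho> u'" using root(2) e by metis+
    show "h v \<le> h v'"
    proof (cases "\<rho> u = \<rho> u'")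
      case False
      then have "f (\<rho> u) \<noteq> f (\<rho> u')" using f(1) rootV V by (auto simp: inj_on_def)
      moreover have "f (\<rho> u) \<le> f (\<rho> u')"
        using div_le_mono[of "h u" "h u'" N] less hdiv V by simp
      ultimately have "h v div N < h v' div N" using hdiv V \<rho> by simp
      then show ?thesis by (metis div_le_mono linorder_le_cases not_le)
    next
      case True
      have "f v \<le> f v'"
      proof (rule ccontr)
        assume "\<not> f v \<le> f v'"
        then have vv: "f v' < f v" by simp
        have uu: "f u < f u'" using less True by (simp add: h_def)
        have "\<not> f u' < f v" using nested[OF e(1), of u'] V True uu d by auto
        moreover have "u' \<noteq> v" using d by auto
        then have "f u' \<noteq> f v" using f(1) V by (auto simp: inj_on_def)
        ultimately have "f v < f u'" by simp
        have e': "{v', u'} \<in> E" using e(2) by (simp add: insert_commute)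
        have "\<not> f v' < f u" using nested[OF e', of u] V True uu d \<rho> by auto
        moreover have "v' \<noteq> u" using d by auto
        then have "f v' \<noteq> f u" using f(1) V by (auto simp: inj_on_def)
        ultimately have "f u < f v'" by simp
        then show False using noncrossingD[OF f(2) e(1) e'] vv \<open>f v < f u'\<close> by blast
      qed
      then show ?thesis using True \<rho> by (simp add: h_def)
    qed
  qed
qed

theorem theorem12:
  fixes V :: "'a set" and E :: "'a set set"
  assumes "simple_graph V E" and "bipartite V E" and "outerplanar V E"
  shows "leveled_planar V E \<and>
    (\<forall>L. breadth_first_layering V E L \<longrightarrow> (\<exists>p. leveled_planar_drawing V E L p))"
proof (intro conjI allI impI)
  obtain f :: "'a \<Rightarrow> nat" where f: "inj_on f V" "noncrossing E f"
    using outerplanar_imp_noncrossing[OF assms(1,3)] by blast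
  have sym: "(y, x) \<in> (adj E)\<^sup>*" if "(x, y) \<in> (adj E)\<^sup>*" for x y
  proof -
    have "sym (adj E)" by (auto simp: adj_def sym_def insert_commute)
    then show ?thesis using that by (meson symD sym_rtrancl)
  qed
  define \<rho> where "\<rho> v = arg_min f (\<lambda>x. (x, v) \<in> (adj E)\<^sup>*)" for v
  have min: "(\<rho> v, v) \<in> (adj E)\<^sup>* \<and> (\<forall>x. (x, v) \<in> (adj E)\<^sup>* \<longrightarrow> f (\<rho> v) \<le> f x)" for v
    unfolding \<rho>_def by (rule arg_min_nat_lemma) (rule rtrancl_refl)
  have edge: "\<rho> u = \<rho> v" if "{u, v} \<in> E" for u v
  proof -
    have "(u, v) \<in> (adj E)\<^sup>*" using that by (auto simp: adj_def)
    then have "(x, u) \<in> (adj E)\<^sup>* \<longleftrightarrow> (x, v) \<in> (adj E)\<^sup>*" for x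
      using sym by (meson rtrancl_trans)
    then show ?thesis by (simp add: \<rho>_def)
  qed
  have "\<exists>p. leveled_planar_drawing V E (\<lambda>i. {v \<in> V. graph_dist E (\<rho> v) v = i}) p"
    using min edge by (intro leveled_planar_drawing_from_roots[OF assms(1,2) f]) auto
  then show "leveled_planar V E" unfolding leveled_planar_def by blast
next
  fix L assume L: "breadth_first_layering V E L"
  then obtain r where r: "r \<in> V" "\<forall>i. L i = {v \<in> V. graph_dist E r v = i}"
    and con: "connected_graph V E"
    unfolding breadth_first_layering_def by blast
  obtain f0 :: "'a \<Rightarrow> nat" where f0: "inj_on f0 V" "noncrossing E f0"
    using outerplanar_imp_noncrossing[OF assms(1,3)] by blast
  obtain f where f: "inj_on f V" "noncrossing E f" "\<And>x. x \<in> V \<Longrightarrow> f r \<le> f x"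
    using noncrossing_rotate[OF assms(1) f0, of r] by blast
  have "\<exists>p. leveled_planar_drawing V E (\<lambda>i. {v \<in> V. graph_dist E r v = i}) p"
    using con r(1) f(3)
    by (intro leveled_planar_drawing_from_roots[OF assms(1,2) f(1,2)]) (auto simp: connected_graph_def)
  moreover have "L = (\<lambda>i. {v \<in> V. graph_dist E r v = i})" using r(2) by blast
  ultimately show "\<exists>p. leveled_planar_drawing V E L p" by simp
qed

end
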